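(* Let $k,\nu>0$ and let $m\in\mathbb{N}\cup\{0\}$. Then for $0<x<y$, $$\frac{\Psi_{k,\nu}^{(2m-1)}(y)-\Psi_{k,\nu}^{(2m-1)}(x)}{y-x}\leq \Psi_{k,\nu}^{(2m)}\left(\frac{x+y}{2}\right)$$ and $$\Psi_{k,\nu}^{(2m+1)}\left(\frac{x+y}{2}\right)\leq \frac{\Psi_{k,\nu}^{(2m)}(y)-\Psi_{k,\nu}^{(2m)}(x)}{y-x}.$$
   Context: For $k>0$, $\nu>0$, the $(k,\nu)$ Gamma function is defined (here for $x>0$) by $$\Gamma_{k,\nu}(x)=\lim_{n\to\infty}\frac{n!\,(k\nu)^n\left(\frac{nk}{\nu}\right)^{\frac{x}{k\nu}-1}}{(x)_{n,k\nu}},$$ where for $a\in\mathbb{R}$ and $n\in\mathbb{N}$, $(x)_{n,a}=x(x+a)\cdots(x+(n-1)a)$. The $(k,\nu)$ psi (digamma) function is $\Psi_{k,\nu}(x)=\frac{d}{dx}\ln\Gamma_{k,\nu}(x)$. For an integer $m>0$, $\Psi_{k,\nu}^{(m)}$ denotes the $m$-th derivative of $\Psi_{k,\nu}$ with respect to $x$; moreover $\Psi_{k,\nu}^{(0)}=\Psi_{k,\nu}$ and $\Psi_{k,\nu}^{(-1)}=\ln\Gamma_{k,\nu}$. *)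

theory Defs
  imports "HOL-Analysis.Analysis"
begin

definition gpoch :: "real \<Rightarrow> nat \<Rightarrow> real \<Rightarrow> real" where
  "gpoch x n a = (\<Prod>j<n. x + real j * a)"

(* Only meaningful for x > 0, where the limit exists and is positive. *)
definition Gamma_kn :: "real \<Rightarrow> real \<Rightarrow> real \<Rightarrow> real" where
  "Gamma_kn k \<nu> x =
     lim (\<lambda>n. fact n * (k * \<nu>) ^ n * (real n * k / \<nu>) powr (x / (k * \<nu>) - 1)
              / gpoch x n (k * \<nu>))"

definition Psi_kn :: "real \<Rightarrow> real \<Rightarrow> real \<Rightarrow> real" where
  "Psi_kn k \<nu> = deriv (\<lambda>x. ln (Gamma_kn k \<nu> x))"

(* The order is an integer because order -1 denotes ln Gamma_kn.
   Orders below -1 have no meaning; they get the value of order 0. *)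
definition Psi_kn_deriv :: "int \<Rightarrow> real \<Rightarrow> real \<Rightarrow> real \<Rightarrow> real" where
  "Psi_kn_deriv m k \<nu> =
     (if m = -1 then (\<lambda>x. ln (Gamma_kn k \<nu> x)) else (deriv ^^ nat m) (Psi_kn k \<nu>))"

end

theory Submission
  imports Defs
begin

text \<open>
  Write \<open>c = k\<nu>\<close>. Rescaling the product \<open>x (x + c) \<cdots> (x + (n-1) c)\<close> by \<open>c\<close> turns it into an
  ordinary Pochhammer symbol at \<open>x / c\<close>, and the limit becomes Euler's limit for the classical
  Gamma function up to an exponential factor:
  \<open>\<Gamma>\<^bsub>k,\<nu>\<^esub>(x) = (k/\<nu>)\<^bsup>x/c - 1\<^esup> \<Gamma>(x/c)\<close> (\<open>Gamma_kn_eq_Gamma\<close>). Taking logarithms, that factor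
  contributes an affine function, so every derivative of \<open>\<Psi>\<^bsub>k,\<nu>\<^esub>\<close> is a rescaled polygamma
  function, up to a constant at order 0 (\<open>Psi_kn_deriv_eq_Polygamma\<close>).

  Polygamma functions of odd order are positive on the positive axis, and those of positive even
  order are negative. Looking two orders up, \<open>\<Psi>\<^bsub>k,\<nu>\<^esub>\<close> is therefore concave at even orders and
  convex at odd orders. Each of the two inequalities compares the mean of a derivative over
  \<open>[x, y]\<close> with its value at the midpoint, which is one half of the Hermite--Hadamard inequality
  for a concave, respectively convex, derivative (\<open>convex_deriv_midpoint_le_slope\<close>).
\<close>

section \<open>The midpoint half of the Hermite--Hadamard inequality\<close>

text \<open>
  For a convex function \<open>f'\<close>, moving symmetrically away from the midpoint \<open>c\<close> increases
  \<open>f' (c + t) + f' (c - t)\<close>, so \<open>f (c + t) - f (c - t) - 2 t f' c\<close> is nondecreasing in \<open>t\<close>; it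
  vanishes at \<open>t = 0\<close>. This avoids integrals, and hence any integrability argument.
\<close>
lemma convex_deriv_midpoint_le_slope:
  fixes f f' :: "real \<Rightarrow> real"
  assumes "x < y"
    and deriv: "\<And>t. t \<in> {x..y} \<Longrightarrow> (f has_real_derivative f' t) (at t)"
    and convex: "convex_on {x..y} f'"
  shows "f' ((x + y) / 2) \<le> (f y - f x) / (y - x)"
proof -
  define c r where "c = (x + y) / 2" and "r = (y - x) / 2"
  define h where "h = (\<lambda>t. f (c + t) - f (c - t) - 2 * t * f' c)"
  have "h 0 \<le> h r"
  proof (rule DERIV_nonneg_imp_nondecreasing[where f = h])
    show "0 \<le> r" using \<open>x < y\<close> by (simp add: r_def)
    fix t assume t: "0 \<le> t" "t \<le> r"
    have mem: "c + t \<in> {x..y}" "c - t \<in> {x..y}"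
      using t by (auto simp: c_def r_def field_simps)
    have "((\<lambda>t. f (c + t)) has_real_derivative f' (c + t) * 1) (at t)"
      by (rule DERIV_chain2[where f = f]) (use mem in \<open>auto intro!: derivative_eq_intros deriv\<close>)
    moreover have "((\<lambda>t. f (c - t)) has_real_derivative f' (c - t) * (-1)) (at t)"
      by (rule DERIV_chain2[where f = f]) (use mem in \<open>auto intro!: derivative_eq_intros deriv\<close>)
    moreover have "((\<lambda>t. 2 * t * f' c) has_real_derivative 2 * f' c) (at t)"
      by (auto intro!: derivative_eq_intros)
    ultimately have "(h has_real_derivative (f' (c + t) * 1 - f' (c - t) * (-1) - 2 * f' c)) (at t)"
      unfolding h_def by (intro DERIV_diff)
    moreover have "f' ((1 - 1/2) *\<^sub>R (c + t) + (1/2) *\<^sub>R (c - t))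
        \<le> (1 - 1/2) * f' (c + t) + 1/2 * f' (c - t)"
      by (rule convex_onD[OF convex]) (use mem in auto)
    hence "0 \<le> f' (c + t) * 1 - f' (c - t) * (-1) - 2 * f' c"
      by (simp add: field_simps)
    ultimately show "\<exists>d. (h has_real_derivative d) (at t) \<and> 0 \<le> d" by blast
  qed
  moreover have "c + r = y" "c - r = x" "2 * r = y - x"
    by (simp_all add: c_def r_def field_simps)
  ultimately have "(y - x) * f' c \<le> f y - f x"
    by (simp add: h_def)
  thus ?thesis
    using \<open>x < y\<close> by (simp add: c_def pos_le_divide_eq mult.commute)
qed

lemma concave_deriv_slope_le_midpoint:
  fixes f f' :: "real \<Rightarrow> real"
  assumes "x < y"
    and deriv: "\<And>t. t \<in> {x..y} \<Longrightarrow> (f has_real_derivative f' t) (at t)"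
    and concave: "concave_on {x..y} f'"
  shows "(f y - f x) / (y - x) \<le> f' ((x + y) / 2)"
proof -
  have "- f' ((x + y) / 2) \<le> ((- f y) - (- f x)) / (y - x)"
    by (rule convex_deriv_midpoint_le_slope[OF \<open>x < y\<close>])
      (use deriv concave in \<open>auto simp: concave_on_def intro!: DERIV_minus\<close>)
  also have "\<dots> = - ((f y - f x) / (y - x))"
    by (simp add: minus_divide_left)
  finally show ?thesis by simp
qed

section \<open>Reduction to the classical Gamma and polygamma functions\<close>

lemma gpoch_eq_pochhammer:
  assumes "c \<noteq> 0"
  shows "gpoch x n c = c ^ n * pochhammer (x / c) n"
proof -
  have "gpoch x n c = (\<Prod>j<n. c * (x / c + real j))"
    using assms by (simp add: gpoch_def distrib_left mult.commute)
  also have "\<dots> = c ^ n * pochhammer (x / c) n"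
    by (simp add: prod.distrib pochhammer_prod atLeast0LessThan)
  finally show ?thesis .
qed

lemma Gamma_kn_eq_Gamma:
  assumes "k > 0" "\<nu> > 0" "x > 0"
  shows "Gamma_kn k \<nu> x = (k / \<nu>) powr (x / (k * \<nu>) - 1) * Gamma (x / (k * \<nu>))"
proof -
  define c z where "c = k * \<nu>" and "z = x / c"
  have pos: "c > 0" "z > 0" using assms by (simp_all add: c_def z_def)
  have "(\<lambda>n. (k / \<nu>) powr (z - 1) * Gamma_series' z n) \<longlonglongrightarrow> (k / \<nu>) powr (z - 1) * Gamma z"
    by (intro tendsto_intros Gamma_series'_LIMSEQ)
  moreover have "\<forall>\<^sub>F n in sequentially. (k / \<nu>) powr (z - 1) * Gamma_series' z n =
      fact n * c ^ n * (real n * k / \<nu>) powr (z - 1) / gpoch x n c"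
    using eventually_gt_at_top[of 0]
  proof eventually_elim
    case (elim n)
    have "(real n * k / \<nu>) powr (z - 1) = (k / \<nu>) powr (z - 1) * real n powr (z - 1)"
      using assms powr_mult[of "k / \<nu>" "real n" "z - 1"] by (simp add: mult.commute)
    \<comment> \<open>The exponent \<open>z - 1\<close> instead of \<open>z\<close> is what turns \<open>n!\<close> into the \<open>(n - 1)!\<close> of Euler's limit.\<close>
    moreover have "fact n * real n powr (z - 1) = fact (n - 1) * exp (z * ln (real n))"
      using elim by (simp add: fact_reduce powr_def left_diff_distrib exp_diff)
    ultimately show ?case
      using pos unfolding gpoch_eq_pochhammer[OF less_imp_neq[OF pos(1), symmetric]]
      by (simp add: Gamma_series'_def field_simps flip: z_def)
  qed
  ultimately have "(\<lambda>n. fact n * c ^ n * (real n * k / \<nu>) powr (z - 1) / gpoch x n c)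
      \<longlonglongrightarrow> (k / \<nu>) powr (z - 1) * Gamma z"
    by (rule Lim_transform_eventually)
  thus ?thesis
    unfolding Gamma_kn_def c_def z_def by (rule limI)
qed

lemma ln_Gamma_kn_eq:
  assumes "k > 0" "\<nu> > 0" "x > 0"
  shows "ln (Gamma_kn k \<nu> x) = (x / (k * \<nu>) - 1) * ln (k / \<nu>) + ln_Gamma (x / (k * \<nu>))"
  using assms by (simp add: Gamma_kn_eq_Gamma ln_mult ln_powr Gamma_real_pos_exp)

lemma has_real_derivative_ln_Gamma_kn:
  assumes "k > 0" "\<nu> > 0" "x > 0"
  shows "((\<lambda>x. ln (Gamma_kn k \<nu> x)) has_real_derivative
           (Digamma (x / (k * \<nu>)) + ln (k / \<nu>)) / (k * \<nu>)) (at x)"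
proof (rule has_field_derivative_transform_within_open[where S = "{0<..}"])
  show "((\<lambda>x. (x / (k * \<nu>) - 1) * ln (k / \<nu>) + ln_Gamma (x / (k * \<nu>))) has_real_derivative
           (Digamma (x / (k * \<nu>)) + ln (k / \<nu>)) / (k * \<nu>)) (at x)"
    using assms by (auto intro!: derivative_eq_intros simp: field_simps)
qed (use assms in \<open>auto simp: ln_Gamma_kn_eq\<close>)

lemma Psi_kn_eq_Digamma:
  assumes "k > 0" "\<nu> > 0" "x > 0"
  shows "Psi_kn k \<nu> x = (Digamma (x / (k * \<nu>)) + ln (k / \<nu>)) / (k * \<nu>)"
  unfolding Psi_kn_def by (rule DERIV_imp_deriv[OF has_real_derivative_ln_Gamma_kn[OF assms]])

lemma pos_real_notin_nonpos_Ints: "x > 0 \<Longrightarrow> x \<notin> \<int>\<^sub>\<le>\<^sub>0" for x :: real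
  by (auto elim!: nonpos_Ints_cases')

lemma has_real_derivative_Polygamma_rescaled:
  assumes "c > 0" "x > 0"
  shows "((\<lambda>x. (Polygamma n (x / c) + b) / c ^ Suc n) has_real_derivative
           Polygamma (Suc n) (x / c) / c ^ Suc (Suc n)) (at x)"
proof -
  have "x / c \<notin> \<int>\<^sub>\<le>\<^sub>0"
    using assms by (intro pos_real_notin_nonpos_Ints) simp
  thus ?thesis
    using assms by (auto intro!: derivative_eq_intros simp: field_simps)
qed

text \<open>
  At order 0 the additive constant is the slope left behind by the exponential factor of
  \<open>Gamma_kn_eq_Gamma\<close>; one more differentiation removes it.
\<close>
lemma Psi_kn_deriv_eq_Polygamma:
  assumes "k > 0" "\<nu> > 0" "x > 0"
  shows "Psi_kn_deriv (int n) k \<nu> x =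
           (Polygamma n (x / (k * \<nu>)) + (if n = 0 then ln (k / \<nu>) else 0)) / (k * \<nu>) ^ Suc n"
  using \<open>x > 0\<close>
proof (induction n arbitrary: x)
  case 0
  thus ?case using assms by (simp add: Psi_kn_deriv_def Psi_kn_eq_Digamma)
next
  case (Suc n)
  have "(Psi_kn_deriv (int n) k \<nu> has_real_derivative
           Polygamma (Suc n) (x / (k * \<nu>)) / (k * \<nu>) ^ Suc (Suc n)) (at x)"
  proof (rule has_field_derivative_transform_within_open[where S = "{0<..}"])
    show "((\<lambda>x. (Polygamma n (x / (k * \<nu>)) + (if n = 0 then ln (k / \<nu>) else 0)) / (k * \<nu>) ^ Suc n)
        has_real_derivative Polygamma (Suc n) (x / (k * \<nu>)) / (k * \<nu>) ^ Suc (Suc n)) (at x)"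
      using assms Suc.prems by (intro has_real_derivative_Polygamma_rescaled) auto
  qed (use Suc in auto)
  moreover have "Psi_kn_deriv (int (Suc n)) k \<nu> = deriv (Psi_kn_deriv (int n) k \<nu>)"
    by (simp add: Psi_kn_deriv_def nat_add_distrib)
  ultimately show ?case
    by (simp add: DERIV_imp_deriv)
qed

text \<open>Order \<open>-1\<close>, the logarithm of the Gamma function, fits into the same scale of derivatives.\<close>
lemma has_real_derivative_Psi_kn_deriv:
  assumes "k > 0" "\<nu> > 0" "x > 0" "j \<ge> -1"
  shows "(Psi_kn_deriv j k \<nu> has_real_derivative Psi_kn_deriv (j + 1) k \<nu> x) (at x)"
proof (cases "j = -1")
  case True
  thus ?thesis
    using has_real_derivative_ln_Gamma_kn[of k \<nu> x] assms
    by (simp add: Psi_kn_deriv_def Psi_kn_eq_Digamma)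
next
  case False
  then obtain n where n: "j = int n"
    using \<open>j \<ge> -1\<close> by (cases j) auto
  have "((\<lambda>x. (Polygamma n (x / (k * \<nu>)) + (if n = 0 then ln (k / \<nu>) else 0)) / (k * \<nu>) ^ Suc n)
      has_real_derivative Polygamma (Suc n) (x / (k * \<nu>)) / (k * \<nu>) ^ Suc (Suc n)) (at x)"
    using assms by (intro has_real_derivative_Polygamma_rescaled) auto
  hence "(Psi_kn_deriv (int n) k \<nu> has_real_derivative
      Polygamma (Suc n) (x / (k * \<nu>)) / (k * \<nu>) ^ Suc (Suc n)) (at x)"
    by (rule has_field_derivative_transform_within_open[where S = "{0<..}"])
      (use assms in \<open>auto simp: Psi_kn_deriv_eq_Polygamma\<close>)
  thus ?thesis
    using assms Psi_kn_deriv_eq_Polygamma[of k \<nu> x "Suc n"] by (simp add: n add.commute)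
qed

section \<open>Convexity by parity of the order\<close>

lemma convex_on_Psi_kn_deriv_odd:
  assumes "k > 0" "\<nu> > 0" "0 < x" "odd n"
  shows "convex_on {x..y} (Psi_kn_deriv (int n) k \<nu>)"
proof (rule f''_ge0_imp_convex)
  fix t assume "t \<in> {x..y}"
  hence t: "t > 0" using \<open>0 < x\<close> by simp
  show "(Psi_kn_deriv (int n) k \<nu> has_real_derivative Psi_kn_deriv (int (Suc n)) k \<nu> t) (at t)"
    using has_real_derivative_Psi_kn_deriv[of k \<nu> t "int n"] assms t by (simp add: add.commute)
  show "(Psi_kn_deriv (int (Suc n)) k \<nu> has_real_derivative
      Psi_kn_deriv (int (Suc (Suc n))) k \<nu> t) (at t)"
    using has_real_derivative_Psi_kn_deriv[of k \<nu> t "int (Suc n)"] assms t by (simp add: add.commute)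
  show "0 \<le> Psi_kn_deriv (int (Suc (Suc n))) k \<nu> t"
    using assms t Polygamma_real_odd_pos[OF pos_real_notin_nonpos_Ints, of "t / (k * \<nu>)" "Suc (Suc n)"]
    by (simp add: Psi_kn_deriv_eq_Polygamma del: of_nat_Suc)
qed simp

lemma concave_on_Psi_kn_deriv_even:
  assumes "k > 0" "\<nu> > 0" "0 < x" "even n"
  shows "concave_on {x..y} (Psi_kn_deriv (int n) k \<nu>)"
proof (rule f''_le0_imp_concave)
  fix t assume "t \<in> {x..y}"
  hence t: "t > 0" using \<open>0 < x\<close> by simp
  show "(Psi_kn_deriv (int n) k \<nu> has_real_derivative Psi_kn_deriv (int (Suc n)) k \<nu> t) (at t)"
    using has_real_derivative_Psi_kn_deriv[of k \<nu> t "int n"] assms t by (simp add: add.commute)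
  show "(Psi_kn_deriv (int (Suc n)) k \<nu> has_real_derivative
      Psi_kn_deriv (int (Suc (Suc n))) k \<nu> t) (at t)"
    using has_real_derivative_Psi_kn_deriv[of k \<nu> t "int (Suc n)"] assms t by (simp add: add.commute)
  show "Psi_kn_deriv (int (Suc (Suc n))) k \<nu> t \<le> 0"
    using assms t Polygamma_real_even_neg[of "t / (k * \<nu>)" "Suc (Suc n)"]
    by (simp add: Psi_kn_deriv_eq_Polygamma divide_nonpos_pos less_imp_le del: of_nat_Suc)
qed simp

theorem proposition3p8:
  fixes k \<nu> x y :: real and m :: nat
  assumes "k > 0" and "\<nu> > 0" and "0 < x" and "x < y"
  shows "(Psi_kn_deriv (2 * int m - 1) k \<nu> y - Psi_kn_deriv (2 * int m - 1) k \<nu> x) / (y - x)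
           \<le> Psi_kn_deriv (2 * int m) k \<nu> ((x + y) / 2)
       \<and> Psi_kn_deriv (2 * int m + 1) k \<nu> ((x + y) / 2)
           \<le> (Psi_kn_deriv (2 * int m) k \<nu> y - Psi_kn_deriv (2 * int m) k \<nu> x) / (y - x)"
proof (rule conjI)
  have pos: "t > 0" if "t \<in> {x..y}" for t
    using that \<open>0 < x\<close> by simp
  show "(Psi_kn_deriv (2 * int m - 1) k \<nu> y - Psi_kn_deriv (2 * int m - 1) k \<nu> x) / (y - x)
      \<le> Psi_kn_deriv (2 * int m) k \<nu> ((x + y) / 2)"
  proof (rule concave_deriv_slope_le_midpoint[OF \<open>x < y\<close>])
    show "(Psi_kn_deriv (2 * int m - 1) k \<nu> has_real_derivative Psi_kn_deriv (2 * int m) k \<nu> t) (at t)"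
      if "t \<in> {x..y}" for t
      using has_real_derivative_Psi_kn_deriv[of k \<nu> t "2 * int m - 1"] assms pos[OF that] by simp
    show "concave_on {x..y} (Psi_kn_deriv (2 * int m) k \<nu>)"
      using concave_on_Psi_kn_deriv_even[of k \<nu> x "2 * m" y] assms by simp
  qed
  show "Psi_kn_deriv (2 * int m + 1) k \<nu> ((x + y) / 2)
      \<le> (Psi_kn_deriv (2 * int m) k \<nu> y - Psi_kn_deriv (2 * int m) k \<nu> x) / (y - x)"
  proof (rule convex_deriv_midpoint_le_slope[OF \<open>x < y\<close>])
    show "(Psi_kn_deriv (2 * int m) k \<nu> has_real_derivative Psi_kn_deriv (2 * int m + 1) k \<nu> t) (at t)"
      if "t \<in> {x..y}" for t
      using has_real_derivative_Psi_kn_deriv[of k \<nu> t "2 * int m"] assms pos[OF that] by simp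
    show "convex_on {x..y} (Psi_kn_deriv (2 * int m + 1) k \<nu>)"
      using convex_on_Psi_kn_deriv_odd[of k \<nu> x "2 * m + 1" y] assms by (simp add: add.commute)
  qed
qed

end
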